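(* Let $n\ge 5$ and $d\ge 3$ be integers and let $G$ be an $n$-vertex $d$-regular multigraph. If $$\lambda_2(G)<\frac{8n-25}{9n-25}\,d,$$ then $\kappa(G)\ge 2$.
   Context: A multigraph is a finite graph in which multiple edges are allowed but loops are not. The degree of a vertex is the number of edges incident to it (counted with multiplicity), and $G$ is $d$-regular if every vertex has degree $d$. The adjacency matrix $A(G)$ has $(i,j)$ entry equal to the number of edges between vertices $v_i$ and $v_j$; its eigenvalues, listed with multiplicity, are $\lambda_1(G)\ge\lambda_2(G)\ge\cdots\ge\lambda_n(G)$. A multigraph with more than $k$ vertices is $k$-vertex-connected if deleting any set of fewer than $k$ vertices leaves a connected multigraph; the vertex-connectivity $\kappa(G)$ is the maximum $k$ such that $G$ is $k$-vertex-connected (so $\kappa(G)=0$ if $G$ is disconnected). *)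

theory Defs
  imports "Jordan_Normal_Form.Char_Poly" "HOL-Computational_Algebra.Polynomial"
begin

text \<open>Edges are objects of their own, so that parallel edges are distinct edges with
  the same set of ends.\<close>

record ('v, 'e) multigraph =
  verts :: "'v set"
  edges :: "'e set"
  ends :: "'e \<Rightarrow> 'v set"

definition is_multigraph :: "('v, 'e) multigraph \<Rightarrow> bool" where
  "is_multigraph G \<longleftrightarrow> finite (verts G) \<and> finite (edges G) \<and>
     (\<forall>e\<in>edges G. ends G e \<subseteq> verts G \<and> card (ends G e) = 2)"

definition vertex_degree :: "('v, 'e) multigraph \<Rightarrow> 'v \<Rightarrow> nat" where
  "vertex_degree G v = card {e \<in> edges G. v \<in> ends G e}"

definition regular_multigraph :: "nat \<Rightarrow> ('v, 'e) multigraph \<Rightarrow> bool" where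
  "regular_multigraph d G \<longleftrightarrow> (\<forall>v\<in>verts G. vertex_degree G v = d)"

text \<open>The list \<open>vs\<close> fixes the numbering of the vertices that the matrix refers to.\<close>

definition is_vertex_numbering :: "('v, 'e) multigraph \<Rightarrow> 'v list \<Rightarrow> bool" where
  "is_vertex_numbering G vs \<longleftrightarrow> distinct vs \<and> set vs = verts G"

definition adjacency_matrix :: "('v, 'e) multigraph \<Rightarrow> 'v list \<Rightarrow> real mat" where
  "adjacency_matrix G vs = mat (length vs) (length vs)
     (\<lambda>(i, j). real (card {e \<in> edges G. ends G e = {vs ! i, vs ! j}}))"

text \<open>The real eigenvalues in descending order, repeated according to algebraic multiplicity,
  which for a symmetric matrix agrees with the geometric one. The index \<open>k\<close> starts at 1;
  the value is meaningful only if \<open>k\<close> is at most the number of real eigenvalues,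
  which for a symmetric matrix is its dimension.\<close>

definition eigenvalue_list :: "real mat \<Rightarrow> real list" where
  "eigenvalue_list A = rev (sorted_list_of_multiset (proots (char_poly A)))"

definition kth_eigenvalue :: "nat \<Rightarrow> real mat \<Rightarrow> real" where
  "kth_eigenvalue k A = eigenvalue_list A ! (k - 1)"

definition delete_verts :: "('v, 'e) multigraph \<Rightarrow> 'v set \<Rightarrow> ('v, 'e) multigraph" where
  "delete_verts G S =
     G\<lparr>verts := verts G - S, edges := {e \<in> edges G. ends G e \<inter> S = {}}\<rparr>"

definition adjacency_rel :: "('v, 'e) multigraph \<Rightarrow> 'v rel" where
  "adjacency_rel G = {(u, v). \<exists>e\<in>edges G. ends G e = {u, v}}"

definition connected_multigraph :: "('v, 'e) multigraph \<Rightarrow> bool" where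
  "connected_multigraph G \<longleftrightarrow>
     (\<forall>u\<in>verts G. \<forall>v\<in>verts G. (u, v) \<in> (adjacency_rel G)\<^sup>*)"

definition vertex_connected :: "nat \<Rightarrow> ('v, 'e) multigraph \<Rightarrow> bool" where
  "vertex_connected k G \<longleftrightarrow> k < card (verts G) \<and>
     (\<forall>S\<subseteq>verts G. card S < k \<longrightarrow> connected_multigraph (delete_verts G S))"

text \<open>For a nonempty finite vertex set the maximum is over a finite set containing 0.\<close>

definition vertex_connectivity :: "('v, 'e) multigraph \<Rightarrow> nat" where
  "vertex_connectivity G = Max {k. vertex_connected k G}"

end

theory Submission
  imports Defs
begin

text \<open>If the connectivity is at most one, some set \<open>S\<close> of at most one vertex separates the remaining
vertices into nonempty sets \<open>A\<close> and \<open>B\<close> without edges between them. The proof exhibits a function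
on the vertices, constant on \<open>A\<close>, on \<open>B\<close> and on \<open>S\<close>, that varies too little along edges for the
second eigenvalue to be small.

For a \<open>d\<close>-regular multigraph the adjacency form of \<open>f\<close> is \<open>d\<close> times the sum of the squares of
\<open>f\<close> minus the sum of squared differences over the edges. If that sum over the edges is at most
\<open>d - c\<close> times the variance term of \<open>f\<close>, the adjacency form is at least \<open>c\<close> times the squared norm
on the plane spanned by \<open>f\<close> and the constants, and so at least two eigenvalues are at least \<open>c\<close>
(\<open>second_eigenvalue_regular_ge\<close>). The spectral input is that a real symmetric matrix is
orthogonally diagonalizable (\<open>real_symmetric_diagonalization\<close>), which ties the roots of the
characteristic polynomial, with multiplicity, to the quadratic form (\<open>second_eigenvalue_ge\<close>).

If \<open>S\<close> is empty, the indicator of \<open>A\<close> has no variation along edges, and the second eigenvalue is at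
least \<open>d\<close>. If \<open>S\<close> is a cut vertex with \<open>a\<close> edges to \<open>A\<close> and \<open>b\<close> edges to \<open>B\<close>, where \<open>a + b = d\<close>, take
\<open>f\<close> equal to \<open>0\<close> at the cut vertex and to \<open>r\<close> and \<open>s\<close> on the sides. With \<open>p\<close> and \<open>q\<close> vertices on the
sides and \<open>n = p + q + 1\<close>, the inequality for \<open>c = (8 n - 25) / (9 n - 25) d\<close> becomes a condition on
a quadratic form in \<open>r\<close> and \<open>s\<close>, whose discriminant is nonnegative as soon as \<open>p\<close> and \<open>q\<close> are at
least \<open>2\<close> (\<open>part_weights_exist\<close>). If a side has only one vertex, all \<open>d\<close> edges at the cut vertex go
to it, and the indicator of the other side has no variation at all.\<close>

section \<open>Diagonalization of real symmetric matrices\<close>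

lemma symmetric_scalar_prod:
  fixes A :: "'a :: comm_semiring_0 mat"
  assumes A: "A \<in> carrier_mat n n" and sym: "transpose_mat A = A"
    and x: "x \<in> carrier_vec n" and y: "y \<in> carrier_vec n"
  shows "(A *\<^sub>v x) \<bullet> y = x \<bullet> (A *\<^sub>v y)"
  using transpose_vec_mult_scalar[OF A y x] sym by simp

text \<open>The complex matrix has an eigenvalue \<open>a\<close> because its characteristic polynomial has a root.
For an eigenvector \<open>z\<close>, symmetry moves the matrix across \<open>conjugate z \<bullet> z\<close>, which gives both
\<open>a\<close> and its conjugate as factors. So \<open>a\<close> is a root of the real characteristic polynomial.\<close>

lemma symmetric_real_eigenvector_exists:
  fixes A :: "real mat"
  assumes A: "A \<in> carrier_mat n n" and sym: "transpose_mat A = A" and n: "0 < n"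
  obtains e v where "v \<in> carrier_vec n" "v \<noteq> 0\<^sub>v n" "A *\<^sub>v v = e \<cdot>\<^sub>v v"
proof -
  define C where "C = map_mat complex_of_real A"
  have C: "C \<in> carrier_mat n n" using A by (simp add: C_def)
  have symC: "transpose_mat C = C"
  proof (rule eq_matI)
    fix i j assume "i < dim_row C" "j < dim_col C"
    then show "transpose_mat C $$ (i, j) = C $$ (i, j)"
      using arg_cong[OF sym, of "\<lambda>M. M $$ (i, j)"] A by (simp add: C_def)
  qed (use C in auto)
  obtain as where as: "char_poly C = (\<Prod>a\<leftarrow>as. [:- a, 1:])" "length as = n"
    using char_poly_factorized[OF C] by blast
  obtain a bs where "as = a # bs" using as(2) n by (cases as) auto
  then have root: "poly (char_poly C) a = 0" using as(1) by simp
  then obtain z where z: "z \<in> carrier_vec n" "z \<noteq> 0\<^sub>v n" "C *\<^sub>v z = a \<cdot>\<^sub>v z"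
    using C unfolding eigenvalue_root_char_poly[OF C, symmetric] eigenvalue_def eigenvector_def
    by auto
  have cz: "conjugate z \<in> carrier_vec n" using z(1) by simp
  have conjC: "C *\<^sub>v conjugate z = conjugate a \<cdot>\<^sub>v conjugate z"
  proof -
    have "C *\<^sub>v conjugate z = conjugate (C *\<^sub>v z)"
      using A z(1) by (intro eq_vecI) (auto simp: C_def scalar_prod_def)
    then show ?thesis using z(3) conjugate_smult_vec by metis
  qed
  have "conjugate a * (conjugate z \<bullet> z) = a * (conjugate z \<bullet> z)"
    using symmetric_scalar_prod[OF C symC cz z(1)] z cz unfolding conjC z(3) by simp
  moreover have "conjugate z \<bullet> z \<noteq> 0"
    using conjugate_square_eq_0_vec[OF z(1)] z(2) comm_scalar_prod[OF z(1) cz] by simp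
  ultimately have "conjugate a = a" by simp
  then obtain e where e: "a = complex_of_real e" by (metis Reals_cases Reals_cnj_iff conjugate_complex_def)
  have "poly (char_poly A) e = 0"
    using root unfolding C_def of_real_hom.char_poly_hom[OF A] e by simp
  then show ?thesis
    using that A unfolding eigenvalue_root_char_poly[OF A, symmetric] eigenvalue_def eigenvector_def
    by auto
qed

text \<open>This is the Householder reflection that exchanges the first unit vector and the
normalized \<open>v\<close>. It is symmetric and involutive, hence orthogonal, so that conjugation by it
keeps a matrix symmetric.\<close>

lemma reflection_onto_line:
  fixes v :: "real vec"
  assumes v: "v \<in> carrier_vec n" and v0: "v \<noteq> 0\<^sub>v n" and n: "0 < n"
  obtains H k where "H \<in> carrier_mat n n" "transpose_mat H = H" "H * H = 1\<^sub>m n"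
    "col H 0 = k \<cdot>\<^sub>v v"
proof -
  have vv: "v \<bullet> v > 0" using v v0 conjugate_square_greater_0_vec[OF v] by simp
  define k where "k = 1 / sqrt (v \<bullet> v)"
  define u where "u i = k * v $ i" for i
  have uu: "(\<Sum>i<n. u i * u i) = 1"
  proof -
    have "(\<Sum>i<n. u i * u i) = k * k * (v \<bullet> v)"
      using v by (simp add: u_def scalar_prod_def sum_distrib_left atLeast0LessThan mult_ac)
    also have "\<dots> = 1" using vv by (simp add: k_def)
    finally show ?thesis .
  qed
  define w where "w i = u i - (if i = 0 then 1 else 0)" for i :: nat
  define N where "N = (\<Sum>i<n. w i * w i)"
  have N: "N = - 2 * w 0"
  proof -
    have "N = (\<Sum>i<n. u i * u i - (if i = 0 then 2 * u i - 1 else 0))"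
      unfolding N_def w_def by (intro sum.cong) (auto simp: algebra_simps)
    also have "\<dots> = 1 - (2 * u 0 - 1)" using n by (simp add: sum_subtractf uu)
    finally show ?thesis by (simp add: w_def)
  qed
  \<comment> \<open>If \<open>u\<close> already is the first unit vector, then \<open>N = 0\<close> and division by zero makes
    \<open>H\<close> the identity.\<close>
  define H where "H = mat n n (\<lambda>(i, j). (if i = j then 1 else 0) - 2 * w i * w j / N)"
  have H: "H \<in> carrier_mat n n" by (simp add: H_def)
  have "transpose_mat H = H" by (rule eq_matI) (auto simp: H_def)
  moreover have "H * H = 1\<^sub>m n"
  proof (rule eq_matI)
    fix i j assume "i < dim_row (1\<^sub>m n :: real mat)" "j < dim_col (1\<^sub>m n :: real mat)"
    then have i: "i < n" and j: "j < n" by auto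
    have "(H * H) $$ (i, j) = (\<Sum>l<n. ((if i = l then 1 else 0) - 2 * w i * w l / N)
        * ((if l = j then 1 else 0) - 2 * w l * w j / N))"
      using i j by (auto simp: H_def scalar_prod_def atLeast0LessThan intro!: sum.cong)
    also have "\<dots> = (\<Sum>l<n. (if l = i then (if i = j then 1 else 0) - 2 * w i * w j / N else 0)
        - (if l = j then 2 * w i * w j / N else 0) + 4 * w i * w j / N / N * (w l * w l))"
      by (intro sum.cong) (auto simp: algebra_simps)
    also have "\<dots> = (if i = j then 1 else 0) - 4 * w i * w j / N + 4 * w i * w j / N / N * N"
      unfolding sum.distrib sum_subtractf sum_distrib_left[symmetric] N_def[symmetric]
      using i j by simp
    also have "\<dots> = 1\<^sub>m n $$ (i, j)" using i j by (cases "N = 0") auto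
    finally show "(H * H) $$ (i, j) = 1\<^sub>m n $$ (i, j)" .
  qed (auto simp: H_def)
  moreover have "col H 0 = k \<cdot>\<^sub>v v"
  proof (rule eq_vecI)
    fix i assume "i < dim_vec (k \<cdot>\<^sub>v v)"
    then have i: "i < n" using v by simp
    have "col H 0 $ i = (if i = 0 then 1 else 0) - 2 * w i * w 0 / N"
      using i n by (simp add: H_def)
    also have "\<dots> = (if i = 0 then 1 else 0) + w i"
    proof (cases "N = 0")
      case True
      then have "w i * w i = 0"
        using sum_nonneg_eq_0_iff[of "{..<n}" "\<lambda>i. w i * w i"] i unfolding N_def by auto
      then show ?thesis by simp
    next
      case False then show ?thesis using N by (simp add: field_simps)
    qed
    also have "\<dots> = (k \<cdot>\<^sub>v v) $ i" using i v by (simp add: w_def u_def)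
    finally show "col H 0 $ i = (k \<cdot>\<^sub>v v) $ i" .
  qed (use v in \<open>auto simp: H_def\<close>)
  ultimately show ?thesis using that H by blast
qed

text \<open>Conjugating with a reflection that takes the first unit vector to an eigenvector clears the first
column apart from the diagonal entry, and by symmetry also the first row. Induction applies to
the remaining block.\<close>

theorem real_symmetric_diagonalization:
  fixes A :: "real mat"
  assumes "A \<in> carrier_mat n n" and "transpose_mat A = A"
  shows "\<exists>U es. U \<in> carrier_mat n n \<and> transpose_mat U * U = 1\<^sub>m n
    \<and> transpose_mat U * A * U = mat_diag n es"
  using assms
proof (induction n arbitrary: A)
  case 0
  then show ?case by (intro exI[of _ "1\<^sub>m 0"] exI) (auto simp: mat_diag_def)
next
  case (Suc n)
  note A = Suc.prems(1) and sym = Suc.prems(2)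
  obtain e v where v: "v \<in> carrier_vec (Suc n)" "v \<noteq> 0\<^sub>v (Suc n)" "A *\<^sub>v v = e \<cdot>\<^sub>v v"
    using symmetric_real_eigenvector_exists[OF A sym] by blast
  obtain H k where H: "H \<in> carrier_mat (Suc n) (Suc n)" "transpose_mat H = H" "H * H = 1\<^sub>m (Suc n)"
    and col: "col H 0 = k \<cdot>\<^sub>v v"
    using reflection_onto_line[OF v(1,2)] by blast
  define A' where "A' = H * A * H"
  have A': "A' \<in> carrier_mat (Suc n) (Suc n)" using A H by (simp add: A'_def)
  have HA: "H * A \<in> carrier_mat (Suc n) (Suc n)" using A H(1) by simp
  have symA': "transpose_mat A' = A'"
    unfolding A'_def transpose_mult[OF HA H(1)] transpose_mult[OF H(1) A] H(2) sym
    by (rule assoc_mult_mat[OF H(1) A H(1), symmetric])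
  have colH: "col H 0 \<in> carrier_vec (Suc n)" unfolding col using v by simp
  have colA': "col A' 0 = e \<cdot>\<^sub>v unit_vec (Suc n) 0"
  proof -
    have AH: "A * H \<in> carrier_mat (Suc n) (Suc n)" using A H(1) by simp
    have "A' = H * (A * H)" unfolding A'_def by (rule assoc_mult_mat[OF H(1) A H(1)])
    then have "col A' 0 = H *\<^sub>v col (A * H) 0" using col_mult2[OF H(1) AH] by simp
    also have "col (A * H) 0 = A *\<^sub>v col H 0" using col_mult2[OF A H(1)] by simp
    finally have "col A' 0 = H *\<^sub>v (A *\<^sub>v col H 0)" .
    also have "A *\<^sub>v col H 0 = e \<cdot>\<^sub>v col H 0"
      using A v unfolding col by (simp add: mult_mat_vec[of _ "Suc n" "Suc n"] smult_smult_assoc mult.commute)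
    also have "H *\<^sub>v (e \<cdot>\<^sub>v col H 0) = e \<cdot>\<^sub>v col (H * H) 0"
      unfolding mult_mat_vec[OF H(1) colH] using col_mult2[OF H(1) H(1)] by simp
    finally show ?thesis unfolding H(3) by simp
  qed
  have first: "A' $$ (i, 0) = (if i = 0 then e else 0)" "A' $$ (0, i) = (if i = 0 then e else 0)"
    if "i < Suc n" for i
  proof -
    show 1: "A' $$ (i, 0) = (if i = 0 then e else 0)"
      using arg_cong[OF colA', of "\<lambda>c. c $ i"] that A' by (auto split: if_splits)
    have "A' $$ (0, i) = transpose_mat A' $$ (i, 0)" using A' that by simp
    then show "A' $$ (0, i) = (if i = 0 then e else 0)" using 1 symA' by metis
  qed
  define B where "B = mat n n (\<lambda>(i, j). A' $$ (Suc i, Suc j))"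
  have B: "B \<in> carrier_mat n n" by (simp add: B_def)
  let ?e = "mat 1 1 (\<lambda>_. e)"
  have block: "A' = four_block_mat ?e (0\<^sub>m 1 n) (0\<^sub>m n 1) B"
    by (rule eq_matI) (use A' first in \<open>auto simp: B_def\<close>)
  have "transpose_mat B = B"
  proof (rule eq_matI)
    fix i j assume "i < dim_row B" "j < dim_col B"
    then show "transpose_mat B $$ (i, j) = B $$ (i, j)"
      using arg_cong[OF symA', of "\<lambda>M. M $$ (Suc i, Suc j)"] A' by (simp add: B_def)
  qed (auto simp: B_def)
  then obtain U es where U: "U \<in> carrier_mat n n" "transpose_mat U * U = 1\<^sub>m n"
    "transpose_mat U * B * U = mat_diag n es"
    using Suc.IH[OF B] by blast
  define W where "W = four_block_mat (1\<^sub>m 1) (0\<^sub>m 1 n) (0\<^sub>m n 1) U"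
  have W: "W \<in> carrier_mat (Suc n) (Suc n)" 
    unfolding W_def using four_block_carrier_mat[OF one_carrier_mat U(1), of 1] by simp
  have Wt: "transpose_mat W = four_block_mat (1\<^sub>m 1) (0\<^sub>m 1 n) (0\<^sub>m n 1) (transpose_mat U)"
    
    unfolding W_def
    by (subst transpose_four_block_mat[OF one_carrier_mat zero_carrier_mat zero_carrier_mat U(1)]) simp
  have block_mult: "four_block_mat P (0\<^sub>m 1 n) (0\<^sub>m n 1) Q * four_block_mat P' (0\<^sub>m 1 n) (0\<^sub>m n 1) Q'
      = four_block_mat (P * P') (0\<^sub>m 1 n) (0\<^sub>m n 1) (Q * Q')"
    if "P \<in> carrier_mat 1 1" "P' \<in> carrier_mat 1 1" "Q \<in> carrier_mat n n" "Q' \<in> carrier_mat n n"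
    for P P' Q Q' :: "real mat"
    by (subst mult_four_block_mat[OF that(1) zero_carrier_mat zero_carrier_mat that(3)
          that(2) zero_carrier_mat zero_carrier_mat that(4)]) (use that in simp)
  have Ut: "transpose_mat U \<in> carrier_mat n n" using U(1) by simp
  have e: "?e \<in> carrier_mat 1 1" by simp
  have WW: "transpose_mat W * W = 1\<^sub>m (Suc n)"
    unfolding Wt unfolding W_def block_mult[OF one_carrier_mat one_carrier_mat Ut U(1)] U(2)
    by simp
  have WA'W: "transpose_mat W * A' * W = mat_diag (Suc n) (case_nat e es)"
  proof -
    have "transpose_mat W * A' * W
        = four_block_mat (1\<^sub>m 1 * ?e * 1\<^sub>m 1) (0\<^sub>m 1 n) (0\<^sub>m n 1) (transpose_mat U * B * U)"
      unfolding Wt block unfolding W_def block_mult[OF one_carrier_mat e Ut B]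
      by (rule block_mult) (use Ut B U(1) in auto)
    also have "\<dots> = four_block_mat ?e (0\<^sub>m 1 n) (0\<^sub>m n 1) (mat_diag n es)"
      unfolding U(3) by simp
    also have "\<dots> = mat_diag (Suc n) (case_nat e es)"
      by (rule eq_matI) (auto simp: mat_diag_def split: nat.split)
    finally show ?thesis .
  qed
  note assoc = assoc_mult_mat[of _ "Suc n" "Suc n" _ "Suc n" _ "Suc n"]
  have Wt_carrier: "transpose_mat W \<in> carrier_mat (Suc n) (Suc n)" using W by simp
  have HW: "H * W \<in> carrier_mat (Suc n) (Suc n)" using H(1) W by simp
  have t: "transpose_mat (H * W) = transpose_mat W * H"
    using transpose_mult[OF H(1) W] H(2) by simp
  have "transpose_mat (H * W) * (H * W) = transpose_mat W * (H * H * W)"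
    unfolding t using H(1) W Wt_carrier by (simp add: assoc)
  then have orth: "transpose_mat (H * W) * (H * W) = 1\<^sub>m (Suc n)"
    unfolding H(3) using W WW by simp
  have diag: "transpose_mat (H * W) * A * (H * W) = mat_diag (Suc n) (case_nat e es)"
    unfolding t WA'W[symmetric] A'_def using H(1) W Wt_carrier A by (simp add: assoc)
  show ?case
    by (intro exI[of _ "H * W"] exI[of _ "case_nat e es"] conjI HW orth diag)
qed

section \<open>Bounding the second eigenvalue from below\<close>

lemma proots_prod_linear_factors:
  "proots (\<Prod>a\<leftarrow>as. [:- a, 1:]) = mset (as :: 'a :: idom list)"
proof (induction as)
  case (Cons a as)
  have "(\<Prod>a\<leftarrow>as. [:- a, 1:]) \<noteq> 0" by (simp add: prod_list_zero_iff image_iff)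
  then show ?case using Cons by (simp add: proots_mult del: mult_pCons_left)
qed simp

lemma eigenvalue_list_diagonalization:
  assumes A: "A \<in> carrier_mat n n" and U: "U \<in> carrier_mat n n" "transpose_mat U * U = 1\<^sub>m n"
    and D: "transpose_mat U * A * U = mat_diag n es"
  shows "eigenvalue_list A = rev (sort (map es [0..<n]))"
proof -
  have UU: "U * transpose_mat U = 1\<^sub>m n"
    using mat_mult_left_right_inverse[of "transpose_mat U" n U] U by simp
  have "similar_mat (mat_diag n es) A"
    unfolding similar_mat_def
    by (intro exI[of _ "transpose_mat U"] exI[of _ U] similar_mat_witI[where n = n])
       (simp_all add: A U UU D)
  then have "char_poly A = char_poly (mat_diag n es)" by (simp add: char_poly_similar)
  also have "\<dots> = (\<Prod>a\<leftarrow>diag_mat (mat_diag n es). [:- a, 1:])"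
    by (rule char_poly_upper_triangular[of _ n]) (auto simp: mat_diag_def)
  also have "diag_mat (mat_diag n es) = map es [0..<n]"
    by (auto simp: diag_mat_def mat_diag_def)
  finally have "proots (char_poly A) = mset (map es [0..<n])"
    by (simp only: proots_prod_linear_factors)
  then show ?thesis by (simp only: eigenvalue_list_def sorted_list_of_multiset_mset)
qed

text \<open>The index \<open>k\<close> is the position of the largest entry if that entry is at least \<open>c\<close>,
and arbitrary otherwise.\<close>

lemma at_most_one_not_below:
  fixes as :: "'a :: linorder list"
  assumes len: "2 \<le> length as" and less: "rev (sort as) ! 1 < c"
  shows "\<exists>k. \<forall>i<length as. i \<noteq> k \<longrightarrow> as ! i < c"
proof -
  define L where "L = rev (sort as)"
  have lenL: "length L = length as" by (simp add: L_def)
  have tail: "L ! j < c" if "j \<in> {1..<length L}" for j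
  proof -
    have "L ! j \<le> L ! 1" 
      using that by (auto simp: L_def rev_nth intro!: sorted_nth_mono)
    then show ?thesis using less by (simp add: L_def)
  qed
  have "{j. j < length L \<and> c \<le> L ! j} \<subseteq> {0}"
  proof
    fix j assume j: "j \<in> {j. j < length L \<and> c \<le> L ! j}"
    show "j \<in> {0}"
    proof (rule ccontr)
      assume "j \<notin> {0}"
      then have "L ! j < c" using j by (intro tail) simp
      then show False using j leD by blast
    qed
  qed
  then have "card {j. j < length L \<and> c \<le> L ! j} \<le> card {0 :: nat}"
    by (intro card_mono) simp_all
  then have "length (filter (\<lambda>x. c \<le> x) L) \<le> 1"
    by (simp add: length_filter_conv_card)
  moreover have "length (filter (\<lambda>x. c \<le> x) L) = length (filter (\<lambda>x. c \<le> x) as)"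
    by (rule mset_eq_length) (simp add: L_def)
  ultimately have card: "card {i. i < length as \<and> c \<le> as ! i} \<le> Suc 0"
    unfolding length_filter_conv_card by simp
  define J where "J = {i. i < length as \<and> c \<le> as ! i}"
  have J: "\<forall>i\<in>J. \<forall>j\<in>J. i = j"
    using card by (subst card_le_Suc0_iff_eq[symmetric]) (simp_all add: J_def)
  define k where "k = (SOME k. k \<in> J)"
  have "as ! i < c" if "i < length as" "i \<noteq> k" for i
  proof (rule ccontr)
    assume "\<not> as ! i < c"
    then have i: "i \<in> J" using that by (simp add: J_def)
    then have "k \<in> J" unfolding k_def by (rule someI)
    then show False using J i that by blast
  qed
  then show ?thesis by blast
qed

text \<open>The easy half of the Courant--Fischer principle. If all eigenvalues but one were below \<open>c\<close>, the
plane spanned by \<open>x\<close> and \<open>y\<close> would contain a nonzero vector orthogonal to the exceptional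
eigenvector, because orthogonality is one linear condition. On that vector the quadratic form is a
combination of eigenvalues below \<open>c\<close> with nonnegative weights that sum to its squared norm.\<close>

lemma second_eigenvalue_ge:
  fixes A :: "real mat"
  assumes A: "A \<in> carrier_mat n n" and sym: "transpose_mat A = A" and n: "2 \<le> n"
    and x: "x \<in> carrier_vec n" and y: "y \<in> carrier_vec n"
    and indep: "\<And>s t. s \<cdot>\<^sub>v x + t \<cdot>\<^sub>v y = 0\<^sub>v n \<Longrightarrow> s = 0 \<and> t = 0"
    and form: "\<And>s t z. z = s \<cdot>\<^sub>v x + t \<cdot>\<^sub>v y \<Longrightarrow> c * (z \<bullet> z) \<le> z \<bullet> (A *\<^sub>v z)"
  shows "c \<le> kth_eigenvalue 2 A"
proof (rule ccontr)
  assume neg: "\<not> c \<le> kth_eigenvalue 2 A"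
  obtain U es where U: "U \<in> carrier_mat n n" "transpose_mat U * U = 1\<^sub>m n"
    "transpose_mat U * A * U = mat_diag n es"
    using real_symmetric_diagonalization[OF A sym] by blast
  have UU: "U * transpose_mat U = 1\<^sub>m n"
    using mat_mult_left_right_inverse[of "transpose_mat U" n U] U by simp
  have "2 \<le> length (map es [0..<n])" using n by simp
  moreover have "rev (sort (map es [0..<n])) ! 1 < c"
    using neg eigenvalue_list_diagonalization[OF A U] by (simp add: kth_eigenvalue_def)
  ultimately obtain k where
    k': "\<forall>i < length (map es [0..<n]). i \<noteq> k \<longrightarrow> map es [0..<n] ! i < c"
    using at_most_one_not_below by blast
  have k: "es i < c" if "i < n" "i \<noteq> k" for i using k' that by simp
  define V where "V = transpose_mat U"
  have V: "V \<in> carrier_mat n n" using U by (simp add: V_def)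
  \<comment> \<open>The index \<open>k\<close> may lie outside the range. Then no component has to vanish, and the
    coefficients \<open>0\<close> and \<open>1\<close> make the choice of \<open>s\<close> and \<open>t\<close> below still valid.\<close>
  define a b where "a = (if k < n then (V *\<^sub>v x) $ k else 0)"
    and "b = (if k < n then (V *\<^sub>v y) $ k else 1)"
  \<comment> \<open>a nonzero vector of the plane without component along the exceptional eigenvector\<close>
  define s t where "s = (if a = 0 \<and> b = 0 then 1 else b)"
    and "t = (if a = 0 \<and> b = 0 then 0 else - a)"
  have st: "s \<noteq> 0 \<or> t \<noteq> 0" "s * a + t * b = 0" by (auto simp: s_def t_def)
  define z where "z = s \<cdot>\<^sub>v x + t \<cdot>\<^sub>v y"
  have z: "z \<in> carrier_vec n" using x y by (simp add: z_def)
  have z0: "z \<noteq> 0\<^sub>v n" using indep[of s t] st(1) by (auto simp: z_def)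
  define w where "w = V *\<^sub>v z"
  have w: "w \<in> carrier_vec n" using V z by (simp add: w_def)
  have Uw: "U *\<^sub>v w = z"
    using U V z UU by (simp add: w_def V_def assoc_mult_mat_vec[symmetric, of U n n _ n])
  have wk: "w $ k = 0" if "k < n"
  proof -
    have "w = s \<cdot>\<^sub>v (V *\<^sub>v x) + t \<cdot>\<^sub>v (V *\<^sub>v y)"
      using V x y by (simp add: w_def z_def mult_add_distrib_mat_vec[of _ n n] mult_mat_vec[of _ n n])
    then show ?thesis using that st(2) V x y by (simp add: a_def b_def)
  qed
  have w0: "w \<noteq> 0\<^sub>v n"
  proof
    assume "w = 0\<^sub>v n"
    then have "z = 0\<^sub>v n" using Uw U by auto
    then show False using z0 by simp
  qed
  have norm: "z \<bullet> z = w \<bullet> w"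
    using transpose_vec_mult_scalar[OF U(1) w z] comm_scalar_prod[OF z] 
    by (simp add: Uw V_def[symmetric] w_def[symmetric])
  have "z \<bullet> (A *\<^sub>v z) = w \<bullet> (mat_diag n es *\<^sub>v w)"
  proof -
    have "mat_diag n es *\<^sub>v w = V *\<^sub>v (A *\<^sub>v z)"
      unfolding U(3)[symmetric] Uw[symmetric] V_def[symmetric]
      using V A U(1) w by (simp add: assoc_mult_mat_vec[of _ n n _ n] assoc_mult_mat[of _ n n _ n _ n])
    moreover have "w \<bullet> (V *\<^sub>v (A *\<^sub>v z)) = (A *\<^sub>v z) \<bullet> (U *\<^sub>v w)"
      using transpose_vec_mult_scalar[OF U(1) w, of "A *\<^sub>v z"]
        comm_scalar_prod[OF w, of "V *\<^sub>v (A *\<^sub>v z)"] A z V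
      by (simp add: V_def)
    ultimately show ?thesis using comm_scalar_prod[OF z, of "A *\<^sub>v z"] A z Uw by simp
  qed
  also have "\<dots> = (\<Sum>i<n. es i * (w $ i)\<^sup>2)"
  proof -
    have "(mat_diag n es *\<^sub>v w) $ i = es i * w $ i" if "i < n" for i
      using w that
      by (simp add: mat_diag_def scalar_prod_def atLeast0LessThan if_distrib[of "\<lambda>a. a * _"] cong: if_cong)
    moreover have "dim_vec (mat_diag n es *\<^sub>v w) = n" by (simp add: mat_diag_def)
    ultimately show ?thesis
      by (auto simp: scalar_prod_def atLeast0LessThan power2_eq_square intro!: sum.cong)
  qed
  also have "\<dots> < (\<Sum>i<n. c * (w $ i)\<^sup>2)"
  proof (rule sum_strict_mono_ex1)
    show "\<forall>i\<in>{..<n}. es i * (w $ i)\<^sup>2 \<le> c * (w $ i)\<^sup>2"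
    proof
      fix i assume "i \<in> {..<n}"
      then show "es i * (w $ i)\<^sup>2 \<le> c * (w $ i)\<^sup>2"
        using k[of i] wk by (cases "i = k") (auto intro: mult_right_mono)
    qed
    have "\<exists>i<n. w $ i \<noteq> 0"
    proof (rule ccontr)
      assume "\<not> (\<exists>i<n. w $ i \<noteq> 0)"
      then have "w = 0\<^sub>v n" using w by (intro eq_vecI) auto
      then show False using w0 by simp
    qed
    then obtain i where i: "i < n" "w $ i \<noteq> 0" by blast
    then have "i \<noteq> k" using wk by auto
    then have "es i < c" using k i(1) by blast
    then show "\<exists>i\<in>{..<n}. es i * (w $ i)\<^sup>2 < c * (w $ i)\<^sup>2"
      using i by (intro bexI[of _ i]) auto
  qed simp
  also have "\<dots> = c * (z \<bullet> z)"
    using w unfolding norm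
    by (simp add: scalar_prod_def sum_distrib_left atLeast0LessThan power2_eq_square)
  finally show False using form[OF z_def] by simp
qed

section \<open>Test functions on regular multigraphs\<close>

definition edge_mult :: "('v, 'e) multigraph \<Rightarrow> 'v \<Rightarrow> 'v \<Rightarrow> real" where
  "edge_mult G u v = real (card {e \<in> edges G. ends G e = {u, v}})"

lemma edge_mult_commute: "edge_mult G u v = edge_mult G v u"
  by (simp add: edge_mult_def insert_commute)

lemma edge_mult_self:
  assumes "is_multigraph G"
  shows "edge_mult G v v = 0"
proof -
  have none: "{e \<in> edges G. ends G e = {v, v}} = {}"
    using assms by (auto simp: is_multigraph_def)
  show ?thesis unfolding edge_mult_def none by simp
qed

lemma sum_edge_mult:
  assumes G: "is_multigraph G" and v: "v \<in> verts G"
  shows "(\<Sum>u\<in>verts G. edge_mult G v u) = real (vertex_degree G v)"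
proof -
  let ?E = "\<lambda>u. {e \<in> edges G. ends G e = {v, u}}"
  have fin: "finite (verts G)" "finite (edges G)" using G by (auto simp: is_multigraph_def)
  have "{e \<in> edges G. v \<in> ends G e} \<subseteq> (\<Union>u\<in>verts G. ?E u)"
  proof
    fix e assume e: "e \<in> {e \<in> edges G. v \<in> ends G e}"
    then have "card (ends G e) = 2" "ends G e \<subseteq> verts G"
      using G by (auto simp: is_multigraph_def)
    then obtain a b where ab: "ends G e = {a, b}" by (auto simp: card_2_iff)
    then show "e \<in> (\<Union>u\<in>verts G. ?E u)"
      using e \<open>ends G e \<subseteq> verts G\<close> by auto
  qed
  then have "{e \<in> edges G. v \<in> ends G e} = (\<Union>u\<in>verts G. ?E u)" by auto
  then have "vertex_degree G v = card (\<Union>u\<in>verts G. ?E u)" by (simp add: vertex_degree_def)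
  also have "\<dots> = (\<Sum>u\<in>verts G. card (?E u))"
    using fin by (intro card_UN_disjoint) (auto simp: doubleton_eq_iff)
  finally show ?thesis by (simp add: edge_mult_def)
qed

lemma sum_vertex_numbering:
  assumes "is_vertex_numbering G vs"
  shows "(\<Sum>i<length vs. g (vs ! i)) = (\<Sum>v\<in>verts G. g v)"
proof -
  have "bij_betw ((!) vs) {..<length vs} (verts G)"
    using assms bij_betw_nth[of vs] by (auto simp: is_vertex_numbering_def)
  then show ?thesis by (rule sum.reindex_bij_betw)
qed

text \<open>With \<open>m\<close> as edge weights, the left side is twice the quadratic form of the Laplacian, since each
edge is counted from both of its ends; regularity makes the Laplacian \<open>d\<close> times the identity minus the adjacency matrix.\<close>

lemma sum_squared_differences:
  fixes m :: "'v \<Rightarrow> 'v \<Rightarrow> real"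
  assumes sym: "\<And>u v. m u v = m v u" and row: "\<And>v. v \<in> V \<Longrightarrow> (\<Sum>u\<in>V. m v u) = d"
  shows "(\<Sum>u\<in>V. \<Sum>v\<in>V. m u v * (f u - f v)\<^sup>2)
    = 2 * (d * (\<Sum>v\<in>V. (f v)\<^sup>2) - (\<Sum>u\<in>V. f u * (\<Sum>v\<in>V. m u v * f v)))"
proof -
  have 1: "(\<Sum>u\<in>V. \<Sum>v\<in>V. m u v * (f u)\<^sup>2) = d * (\<Sum>v\<in>V. (f v)\<^sup>2)"
    by (simp add: sum_distrib_right[symmetric] row sum_distrib_left)
  have 2: "(\<Sum>u\<in>V. \<Sum>v\<in>V. m u v * (f v)\<^sup>2) = d * (\<Sum>v\<in>V. (f v)\<^sup>2)"
    by (subst sum.swap, subst sym) (rule 1)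
  have 3: "(\<Sum>u\<in>V. \<Sum>v\<in>V. m u v * (f u * f v)) = (\<Sum>u\<in>V. f u * (\<Sum>v\<in>V. m u v * f v))"
    by (simp add: sum_distrib_left mult_ac)
  have "(\<Sum>u\<in>V. \<Sum>v\<in>V. m u v * (f u - f v)\<^sup>2)
      = (\<Sum>u\<in>V. \<Sum>v\<in>V. m u v * (f u)\<^sup>2 + m u v * (f v)\<^sup>2 - 2 * (m u v * (f u * f v)))"
    by (simp add: power2_eq_square algebra_simps)
  also have "\<dots> = 2 * (d * (\<Sum>v\<in>V. (f v)\<^sup>2) - (\<Sum>u\<in>V. f u * (\<Sum>v\<in>V. m u v * f v)))"
    unfolding sum.distrib sum_subtractf sum_distrib_left[symmetric] 1 2 3 by simp
  finally show ?thesis .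
qed

text \<open>Among the shifts of \<open>t f\<close> by a constant, the one with mean zero has the least sum of squares,
and that least value is the expression on the left.\<close>

lemma sum_squares_affine_ge:
  fixes f :: "'v \<Rightarrow> real"
  assumes V: "finite V" "V \<noteq> {}"
  shows "t\<^sup>2 * ((\<Sum>v\<in>V. (f v)\<^sup>2) - (\<Sum>v\<in>V. f v)\<^sup>2 / card V) \<le> (\<Sum>v\<in>V. (s + t * f v)\<^sup>2)"
proof -
  define n F Q where "n = real (card V)" and "F = (\<Sum>v\<in>V. f v)" and "Q = (\<Sum>v\<in>V. (f v)\<^sup>2)"
  have n: "n > 0" using V by (simp add: n_def card_gt_0_iff)
  have "(\<Sum>v\<in>V. (s + t * f v)\<^sup>2) = (\<Sum>v\<in>V. s\<^sup>2 + 2 * s * t * f v + t\<^sup>2 * (f v)\<^sup>2)"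
    by (simp add: power2_eq_square algebra_simps)
  also have "\<dots> = n * s\<^sup>2 + 2 * s * t * F + t\<^sup>2 * Q"
    by (simp add: sum.distrib sum_distrib_left n_def F_def Q_def)
  also have "\<dots> = n * (s + t * F / n)\<^sup>2 + t\<^sup>2 * (Q - F\<^sup>2 / n)"
    using n by (simp add: power2_eq_square field_simps)
  also have "\<dots> \<ge> t\<^sup>2 * (Q - F\<^sup>2 / n)" using n by simp
  finally show ?thesis by (simp add: n_def F_def Q_def)
qed

text \<open>The plane to which the min-max principle is applied is spanned by the constants and \<open>f\<close>. Constants
do not contribute to differences, so on this plane the hypothesis on \<open>f\<close> alone controls the
Laplacian form. Subtracting the mean in the variance term replaces orthogonality of \<open>f\<close> to the constants.\<close>

theorem second_eigenvalue_regular_ge: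
  fixes G :: "('v, 'e) multigraph" and f :: "'v \<Rightarrow> real"
  assumes G: "is_multigraph G" "regular_multigraph d G" and vs: "is_vertex_numbering G vs"
    and c: "c \<le> d"
    and ab: "a \<in> verts G" "b \<in> verts G" "f a \<noteq> f b"
    and energy: "(\<Sum>u\<in>verts G. \<Sum>v\<in>verts G. edge_mult G u v * (f u - f v)\<^sup>2)
      \<le> 2 * ((d - c) * ((\<Sum>v\<in>verts G. (f v)\<^sup>2) - (\<Sum>v\<in>verts G. f v)\<^sup>2 / card (verts G)))"
  shows "c \<le> kth_eigenvalue 2 (adjacency_matrix G vs)"
proof -
  let ?V = "verts G" and ?A = "adjacency_matrix G vs"
  define n where "n = length vs"
  have fin: "finite ?V" using G by (simp add: is_multigraph_def)
  have setvs: "set vs = ?V" using vs by (simp add: is_vertex_numbering_def)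
  have A: "?A \<in> carrier_mat n n" by (simp add: adjacency_matrix_def n_def)
  have Aij: "?A $$ (i, j) = edge_mult G (vs ! i) (vs ! j)" if "i < n" "j < n" for i j
    using that by (simp add: adjacency_matrix_def n_def edge_mult_def)
  have sym: "transpose_mat ?A = ?A"
    by (rule eq_matI) (use A Aij edge_mult_commute in auto)
  obtain i j where ij: "i < n" "j < n" "vs ! i = a" "vs ! j = b"
    using ab setvs by (metis in_set_conv_nth n_def)
  then have "i \<noteq> j" using ab by auto
  then have n2: "2 \<le> n" using ij by linarith
  let ?one = "vec n (\<lambda>_. 1 :: real)" and ?f = "vec n (\<lambda>i. f (vs ! i))"
  show ?thesis
  proof (rule second_eigenvalue_ge[OF A sym n2, of ?one ?f])
    fix s t :: real assume "s \<cdot>\<^sub>v ?one + t \<cdot>\<^sub>v ?f = 0\<^sub>v n"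
    then have "(s \<cdot>\<^sub>v ?one + t \<cdot>\<^sub>v ?f) $ l = 0" if "l < n" for l using that by simp
    from this[OF ij(1)] this[OF ij(2)] have "s + t * f a = 0" "s + t * f b = 0"
      using ij by simp_all
    moreover from this have "t * (f a - f b) = 0" unfolding right_diff_distrib by linarith
    ultimately show "s = 0 \<and> t = 0" using ab(3) by simp
  next
    fix s t z assume z: "z = s \<cdot>\<^sub>v ?one + t \<cdot>\<^sub>v ?f"
    define g where "g v = s + t * f v" for v
    have zi: "z $ l = g (vs ! l)" if "l < n" for l using that by (simp add: z g_def)
    have dimz: "dim_vec z = n" by (simp add: z)
    have zz: "z \<bullet> z = (\<Sum>v\<in>?V. (g v)\<^sup>2)"
      unfolding sum_vertex_numbering[OF vs, symmetric]
      by (simp add: scalar_prod_def dimz zi n_def atLeast0LessThan power2_eq_square)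
    have inner: "(\<Sum>j<n. edge_mult G u (vs ! j) * g (vs ! j))
        = (\<Sum>v\<in>?V. edge_mult G u v * g v)" for u
      unfolding n_def by (rule sum_vertex_numbering[OF vs, where g = "\<lambda>v. edge_mult G u v * g v"])
    have "z \<bullet> (?A *\<^sub>v z)
        = (\<Sum>i<n. g (vs ! i) * (\<Sum>j<n. edge_mult G (vs ! i) (vs ! j) * g (vs ! j)))"
      using A dimz by (simp add: scalar_prod_def zi Aij atLeast0LessThan)
    also have "\<dots> = (\<Sum>u\<in>?V. g u * (\<Sum>v\<in>?V. edge_mult G u v * g v))"
      unfolding inner unfolding n_def
      by (rule sum_vertex_numbering[OF vs, where g = "\<lambda>u. g u * (\<Sum>v\<in>?V. edge_mult G u v * g v)"])
    finally have zAz: "z \<bullet> (?A *\<^sub>v z) = (\<Sum>u\<in>?V. g u * (\<Sum>v\<in>?V. edge_mult G u v * g v))" .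
    have row: "(\<Sum>u\<in>?V. edge_mult G v u) = real d" if "v \<in> ?V" for v
      using sum_edge_mult[OF G(1) that] G(2) that by (simp add: regular_multigraph_def)
    have "2 * (d * (z \<bullet> z) - z \<bullet> (?A *\<^sub>v z)) = (\<Sum>u\<in>?V. \<Sum>v\<in>?V. edge_mult G u v * (g u - g v)\<^sup>2)"
      unfolding zz zAz by (rule sum_squared_differences[symmetric, OF edge_mult_commute row])
    also have "\<dots> = t\<^sup>2 * (\<Sum>u\<in>?V. \<Sum>v\<in>?V. edge_mult G u v * (f u - f v)\<^sup>2)"
      unfolding sum_distrib_left
      by (intro sum.cong refl) (simp add: g_def power2_eq_square algebra_simps)
    also have "\<dots> \<le> t\<^sup>2 * (2 * ((d - c) * ((\<Sum>v\<in>?V. (f v)\<^sup>2) - (\<Sum>v\<in>?V. f v)\<^sup>2 / card ?V)))"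
      by (rule mult_left_mono[OF energy]) simp
    also have "\<dots> = 2 * (d - c) * (t\<^sup>2 * ((\<Sum>v\<in>?V. (f v)\<^sup>2) - (\<Sum>v\<in>?V. f v)\<^sup>2 / card ?V))"
      by simp
    also have "\<dots> \<le> 2 * (d - c) * (z \<bullet> z)"
      unfolding zz g_def using c ab(1) fin
      by (intro mult_left_mono sum_squares_affine_ge) auto
    finally show "c * (z \<bullet> z) \<le> z \<bullet> (?A *\<^sub>v z)" by (simp add: algebra_simps)
  qed simp_all
qed

section \<open>Separations by at most one vertex\<close>

text \<open>Here \<open>p\<close>, \<open>q\<close> stand for the sizes of the two sides of a cut vertex and \<open>a\<close>, \<open>b\<close> for the numbers of
edges from it to them; \<open>r\<close>, \<open>s\<close> are the values of the test function on the sides, its value at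
the cut vertex being \<open>0\<close>. The inequality says that the binary quadratic form
\<open>X r\<^sup>2 - 2 Y r s + Z s\<^sup>2\<close> takes a value that is not negative, which fails only if
\<open>X < 0\<close>, \<open>Z < 0\<close> and \<open>X Z > Y\<^sup>2\<close>.

Substituting \<open>a = d - b\<close> and completing the square in \<open>b\<close> shows that \<open>Y\<^sup>2 - X Z\<close> is, up to
a positive factor, a square plus a nonnegative multiple of \<open>(p - 2) (q - 2) (p + q - 2)\<close>. The
vanishing of this product at \<open>p = 2\<close> and at \<open>q = 2\<close> is where the constants of
the bound come from.\<close>

lemma part_weights_exist:
  fixes p q a b d :: real
  assumes pq: "1 \<le> p" "1 \<le> q" "4 \<le> p + q" and d: "0 \<le> d" and ab: "a + b = d"
    and part: "a = 0 \<or> b = 0 \<or> (2 \<le> p \<and> 2 \<le> q)"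
  obtains r s where "r \<noteq> 0 \<or> s \<noteq> 0"
    "a * r\<^sup>2 + b * s\<^sup>2 \<le> d * (p + q + 1) / (9 * (p + q + 1) - 25)
      * (p * r\<^sup>2 + q * s\<^sup>2 - (p * r + q * s)\<^sup>2 / (p + q + 1))"
proof -
  define n where "n = p + q + 1"
  define m where "m = 9 * n - 25"
  have n: "0 < n" and m: "0 < m" using pq by (simp_all add: n_def m_def)
  define X where "X = d * p * (q + 1) / m - a"
  define Z where "Z = d * q * (p + 1) / m - b"
  define Y where "Y = d * p * q / m"
  have form: "d * n / m * (p * r\<^sup>2 + q * s\<^sup>2 - (p * r + q * s)\<^sup>2 / n) - (a * r\<^sup>2 + b * s\<^sup>2)
      = X * r\<^sup>2 - 2 * Y * r * s + Z * s\<^sup>2" for r s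
  proof -
    have "n * (p * r\<^sup>2 + q * s\<^sup>2 - (p * r + q * s)\<^sup>2 / n)
        = p * (q + 1) * r\<^sup>2 - 2 * p * q * r * s + q * (p + 1) * s\<^sup>2"
      using n by (simp add: right_diff_distrib) (simp add: n_def power2_eq_square algebra_simps)
    then have "d / m * (n * (p * r\<^sup>2 + q * s\<^sup>2 - (p * r + q * s)\<^sup>2 / n)) 
        = d / m * (p * (q + 1) * r\<^sup>2 - 2 * p * q * r * s + q * (p + 1) * s\<^sup>2)" by simp
    then show ?thesis by (simp add: X_def Y_def Z_def algebra_simps add_divide_distrib diff_divide_distrib)
  qed
  have "\<exists>r s. (r \<noteq> 0 \<or> s \<noteq> 0) \<and> 0 \<le> X * r\<^sup>2 - 2 * Y * r * s + Z * s\<^sup>2"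
  proof (cases "0 \<le> X \<or> 0 \<le> Z")
    case True
    then show ?thesis
    proof
      assume "0 \<le> X" then show ?thesis by (intro exI[of _ 1] exI[of _ 0]) simp
    next
      assume "0 \<le> Z" then show ?thesis by (intro exI[of _ 0] exI[of _ 1]) simp
    qed
  next
    case False
    then have X: "X < 0" and Z: "Z < 0" by auto
    \<comment> \<open>a side without edges to the cut vertex would make its diagonal coefficient nonnegative\<close>
    have "a \<noteq> 0" "b \<noteq> 0" using False pq d m by (auto simp: X_def Z_def)
    then have p2: "2 \<le> p" "2 \<le> q" using part by auto
    have "4 * m\<^sup>2 * (Y\<^sup>2 - X * Z)
        = 4 * ((d * p * q)\<^sup>2 - (d * p * (q + 1) - m * a) * (d * q * (p + 1) - m * b))"
      using m by (simp add: X_def Y_def Z_def power2_eq_square field_simps)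
    also have "\<dots> = (2 * m * b - d * (m - p * (q + 1) + q * (p + 1)))\<^sup>2
        + d\<^sup>2 * (32 * ((p - 2) * (q - 2) * (p + q - 2)))"
      unfolding ab[symmetric] m_def n_def by (simp add: power2_eq_square algebra_simps)
    also have "\<dots> \<ge> 0" using p2 by simp
    finally have "X * Z \<le> Y\<^sup>2" using m by (simp add: zero_le_mult_iff)
    then have "0 \<le> X * (X * Z - Y\<^sup>2)" using X by (simp add: zero_le_mult_iff)
    also have "\<dots> = X * Y\<^sup>2 - 2 * Y * Y * X + Z * X\<^sup>2" by (simp add: power2_eq_square algebra_simps)
    \<comment> \<open>\<open>(Y, X)\<close> spans the direction in which the form is greatest for fixed \<open>s = X\<close>\<close>
    finally show ?thesis using X by (intro exI[of _ Y] exI[of _ X]) simp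
  qed
  then obtain r s where "r \<noteq> 0 \<or> s \<noteq> 0" "0 \<le> X * r\<^sup>2 - 2 * Y * r * s + Z * s\<^sup>2" by blast
  then show ?thesis using that[of r s] form[of r s] by (simp add: n_def m_def)
qed

lemma disconnected_separation:
  assumes "\<not> connected_multigraph (delete_verts G S)"
  obtains A B where "A \<union> B = verts G - S" "A \<inter> B = {}" "A \<noteq> {}" "B \<noteq> {}"
    "\<And>u w. u \<in> A \<Longrightarrow> w \<in> B \<Longrightarrow> edge_mult G u w = 0"
proof -
  let ?R = "adjacency_rel (delete_verts G S)"
  obtain x y where xy: "x \<in> verts G - S" "y \<in> verts G - S" "(x, y) \<notin> ?R\<^sup>*"
    using assms by (auto simp: connected_multigraph_def delete_verts_def)
  define A where "A = {w \<in> verts G - S. (x, w) \<in> ?R\<^sup>*}"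
  define B where "B = (verts G - S) - A"
  have "edge_mult G u w = 0" if u: "u \<in> A" and w: "w \<in> B" for u w
  proof -
    have "(u, w) \<notin> ?R"
    proof
      assume "(u, w) \<in> ?R"
      then have "(x, w) \<in> ?R\<^sup>*" using u by (auto simp: A_def intro: rtrancl_into_rtrancl)
      then show False using w by (auto simp: A_def B_def)
    qed
    then have none: "{e \<in> edges G. ends G e = {u, w}} = {}"
      using u w by (auto simp: adjacency_rel_def delete_verts_def A_def B_def)
    show ?thesis unfolding edge_mult_def none by simp
  qed
  moreover have "A \<union> B = verts G - S" "A \<inter> B = {}" by (auto simp: A_def B_def)
  moreover have "x \<in> A" "y \<in> B" using xy by (auto simp: A_def B_def)
  ultimately show ?thesis using that by blast
qed

lemma second_eigenvalue_disconnected: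
  fixes G :: "('v, 'e) multigraph"
  assumes G: "is_multigraph G" "regular_multigraph d G" and vs: "is_vertex_numbering G vs"
    and AB: "A \<union> B = verts G" "A \<inter> B = {}" "A \<noteq> {}" "B \<noteq> {}"
    and sep: "\<And>u w. u \<in> A \<Longrightarrow> w \<in> B \<Longrightarrow> edge_mult G u w = 0"
  shows "d \<le> kth_eigenvalue 2 (adjacency_matrix G vs)"
proof -
  obtain x y where xy: "x \<in> A" "y \<in> B" using AB by blast
  define f where "f u = (if u \<in> A then 1 else 0 :: real)" for u
  have "edge_mult G u w * (f u - f w)\<^sup>2 = 0" if "u \<in> verts G" "w \<in> verts G" for u w
    using that sep[of u w] sep[of w u] AB edge_mult_commute[of G u w] by (auto simp: f_def)
  then have energy: "(\<Sum>u\<in>verts G. \<Sum>w\<in>verts G. edge_mult G u w * (f u - f w)\<^sup>2) = 0"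
    by (simp add: sum.neutral)
  have "x \<in> verts G" "y \<in> verts G" "f x \<noteq> f y" using xy AB by (auto simp: f_def)
  then show ?thesis
    by (rule second_eigenvalue_regular_ge[OF G vs order.refl]) (simp add: energy)
qed

text \<open>A side with a single vertex sends all its \<open>d\<close> edges to the cut vertex, which leaves none for the
other side; so either both sides have at least two vertices or one side has no edge to \<open>v\<close>. These are
the cases in which suitable values on the two sides exist.\<close>

lemma second_eigenvalue_cut_vertex:
  fixes G :: "('v, 'e) multigraph"
  assumes G: "is_multigraph G" "regular_multigraph d G" and vs: "is_vertex_numbering G vs"
    and n: "card (verts G) = n" "5 \<le> n"
    and v: "v \<in> verts G"
    and AB: "A \<union> B = verts G - {v}" "A \<inter> B = {}" "A \<noteq> {}" "B \<noteq> {}"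
    and sep: "\<And>u w. u \<in> A \<Longrightarrow> w \<in> B \<Longrightarrow> edge_mult G u w = 0"
  shows "(8 * real n - 25) / (9 * real n - 25) * real d \<le> kth_eigenvalue 2 (adjacency_matrix G vs)"
proof -
  let ?V = "verts G" and ?m = "edge_mult G"
  have V: "?V = insert v (A \<union> B)" "v \<notin> A" "v \<notin> B" using AB v by auto
  have "finite ?V" using G by (simp add: is_multigraph_def)
  then have fin: "finite A" "finite B" unfolding V by auto
  have split: "(\<Sum>u\<in>?V. g u) = g v + (\<Sum>u\<in>A. g u) + (\<Sum>u\<in>B. g u)" for g :: "'v \<Rightarrow> real"
    unfolding V(1) using fin V AB(2) by (simp add: sum.union_disjoint)
  have sep': "?m u w = 0" if "u \<in> B" "w \<in> A" for u w
    using sep[OF that(2,1)] by (simp add: edge_mult_commute)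
  define p q where "p = real (card A)" and "q = real (card B)"
  have npq: "real n = p + q + 1"
    using n fin V AB(2) unfolding V(1) p_def q_def by (simp add: card_Un_disjoint)
  have card1: "1 \<le> card A" "1 \<le> card B" using fin AB by (simp_all add: Suc_le_eq card_gt_0_iff)
  define a b where "a = (\<Sum>u\<in>A. ?m u v)" and "b = (\<Sum>u\<in>B. ?m u v)"
  have row: "(\<Sum>w\<in>?V. ?m u w) = d" if "u \<in> ?V" for u
    using sum_edge_mult[OF G(1) that] G(2) that by (simp add: regular_multigraph_def)
  have ab: "a + b = d"
    using row[OF v] unfolding split a_def b_def edge_mult_self[OF G(1)] by (simp add: edge_mult_commute)
  have part: "a = 0 \<or> b = 0 \<or> (2 \<le> p \<and> 2 \<le> q)"
  proof -
    have "b = 0" if one: "card A = 1"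
    proof -
      obtain u where u: "A = {u}" using one by (rule card_1_singletonE)
      then have "(\<Sum>w\<in>B. ?m u w) = 0" using sep by simp
      then have "a = d" using row[of u] u V(1) unfolding split a_def by (simp add: edge_mult_self[OF G(1)])
      then show ?thesis using ab by simp
    qed
    moreover have "a = 0" if one: "card B = 1"
    proof -
      obtain u where u: "B = {u}" using one by (rule card_1_singletonE)
      then have "(\<Sum>w\<in>A. ?m u w) = 0" using sep' by simp
      then have "b = d" using row[of u] u V(1) unfolding split b_def by (simp add: edge_mult_self[OF G(1)])
      then show ?thesis using ab by simp
    qed
    moreover have "2 \<le> p \<and> 2 \<le> q" if "card A \<noteq> 1" "card B \<noteq> 1"
      using that card1 by (simp add: p_def q_def)
    ultimately show ?thesis by blast
  qed
  have pq: "1 \<le> p" "1 \<le> q" "4 \<le> p + q" using card1 n npq by (simp_all add: p_def q_def)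
  obtain r s where rs: "r \<noteq> 0 \<or> s \<noteq> 0"
    "a * r\<^sup>2 + b * s\<^sup>2 \<le> d * (p + q + 1) / (9 * (p + q + 1) - 25)
      * (p * r\<^sup>2 + q * s\<^sup>2 - (p * r + q * s)\<^sup>2 / (p + q + 1))"
    using part_weights_exist[OF pq _ ab part] by auto
  define f where "f u = (if u \<in> A then r else if u \<in> B then s else 0)" for u
  have f: "f v = 0" "\<And>u. u \<in> A \<Longrightarrow> f u = r" "\<And>u. u \<in> B \<Longrightarrow> f u = s"
    using V AB(2) by (auto simp: f_def)
  have "(\<Sum>u\<in>?V. \<Sum>w\<in>?V. ?m u w * (f u - f w)\<^sup>2) = 2 * (a * r\<^sup>2 + b * s\<^sup>2)"
    unfolding split sum.distrib
    by (simp add: f sep sep' a_def b_def sum_distrib_right edge_mult_self[OF G(1)] edge_mult_commute[of G v])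
  moreover have "(\<Sum>u\<in>?V. (f u)\<^sup>2) = p * r\<^sup>2 + q * s\<^sup>2" "(\<Sum>u\<in>?V. f u) = p * r + q * s"
    unfolding split by (simp_all add: f p_def q_def)
  moreover define c where "c = (8 * real n - 25) / (9 * real n - 25) * real d"
  moreover have dc: "d - c = d * (p + q + 1) / (9 * (p + q + 1) - 25)"
    using pq unfolding c_def npq by (simp add: field_simps)
  ultimately have energy: "(\<Sum>u\<in>?V. \<Sum>w\<in>?V. ?m u w * (f u - f w)\<^sup>2)
      \<le> 2 * ((d - c) * ((\<Sum>u\<in>?V. (f u)\<^sup>2) - (\<Sum>u\<in>?V. f u)\<^sup>2 / card ?V))"
    using rs(2) n npq by simp
  have "0 \<le> d - c" unfolding dc using pq by simp
  obtain x y where xy: "x \<in> A" "y \<in> B" using AB(3,4) by blast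
  have "\<exists>u\<in>?V. f u \<noteq> f v"
  proof (cases "r = 0")
    case True then show ?thesis using rs(1) f(1) f(3)[OF xy(2)] xy V(1) by (intro bexI[of _ y]) simp_all
  next
    case False then show ?thesis using f(1) f(2)[OF xy(1)] xy V(1) by (intro bexI[of _ x]) simp_all
  qed
  then obtain u where "u \<in> ?V" "f u \<noteq> f v" by blast
  then have "c \<le> kth_eigenvalue 2 (adjacency_matrix G vs)"
    using second_eigenvalue_regular_ge[OF G vs _ _ v _ energy] \<open>0 \<le> d - c\<close> by simp
  then show ?thesis by (simp add: c_def)
qed

section \<open>The spectral condition for 2-connectedness\<close>

theorem theorem1p13:
  fixes G :: "('v, 'e) multigraph" and vs :: "'v list" and n d :: nat
  assumes "n \<ge> 5" and "d \<ge> 3"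
    and "is_multigraph G" and "card (verts G) = n" and "regular_multigraph d G"
    and "is_vertex_numbering G vs"
    and "kth_eigenvalue 2 (adjacency_matrix G vs)
           < (8 * real n - 25) / (9 * real n - 25) * real d"
  shows "vertex_connectivity G \<ge> 2"
proof -
  have "vertex_connected 2 G"
  proof (rule ccontr)
    assume "\<not> vertex_connected 2 G"
    then obtain S where S: "S \<subseteq> verts G" "card S < 2" "\<not> connected_multigraph (delete_verts G S)"
      using assms(1,4) by (auto simp: vertex_connected_def)
    obtain A B where AB: "A \<union> B = verts G - S" "A \<inter> B = {}" "A \<noteq> {}" "B \<noteq> {}"
      and sep: "\<And>u w. u \<in> A \<Longrightarrow> w \<in> B \<Longrightarrow> edge_mult G u w = 0"
      using disconnected_separation[OF S(3)] by blast
    have "finite S" using S(1) assms(3) by (auto simp: is_multigraph_def intro: finite_subset)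
    then consider "S = {}" | v where "S = {v}"
      using S(2) by (auto simp: less_2_cases_iff card_1_singleton_iff)
    then show False
    proof cases
      case 1
      have "d \<le> kth_eigenvalue 2 (adjacency_matrix G vs)"
        using second_eigenvalue_disconnected[OF assms(3,5,6) _ AB(2-4) sep] AB(1) 1 by simp
      moreover have "(8 * real n - 25) / (9 * real n - 25) * d \<le> 1 * real d"
        using assms(1) by (intro mult_right_mono) auto
      ultimately show False using assms(7) by simp
    next
      case 2
      then show False
        using second_eigenvalue_cut_vertex[OF assms(3,5,6,4,1) _ _ AB(2-4) sep] AB(1) S(1) assms(7)
        by auto
    qed
  qed
  moreover have "{k. vertex_connected k G} \<subseteq> {..<card (verts G)}"
    by (auto simp: vertex_connected_def)
  ultimately show ?thesis
    unfolding vertex_connectivity_def by (intro Max_ge) (auto intro: finite_subset)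
qed

end
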